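(* Let $X$ be an SRNT graph with parameters $(q,c)$ and let $X_2$ be its second subconstituent (with respect to any vertex). Then the eigenvalue $q(q+c)$ of $X_2$ has multiplicity $1$, and the multiplicities $x,y,z$ of the numbers $q$, $-c$, $-(q+c)$ respectively as eigenvalues of $X_2$ (a multiplicity being $0$ if the number is not an eigenvalue) are $$x=\frac{(q+1)(q^2+qc+c)(q^2+2qc+c^2-2c-q)}{c(c+2q)},$$ $$y=q^2+qc+c-1,$$ $$z=\frac{(q+c-1)(q^2+qc+c)(q^2+q-c)}{c(c+2q)}.$$
   Context: An SRNT graph (strongly regular graph with no triangles) is a finite simple graph, regular of degree $k$, in which any two adjacent vertices have no common neighbours and any two distinct non-adjacent vertices have exactly $c$ common neighbours, with $k\ge 3$ and $k>c\ge 1$. The eigenvalues of its adjacency matrix are $k$ (with multiplicity 1) and the two roots $\lambda_1>\lambda_2$ of $\lambda^2+c\lambda-(k-c)=0$, which are integers. Put $q=\lambda_1$, a positive integer; then $k=c(q+1)+q^2$ and $\lambda_2=-(q+c)$, and $(q,c)$ are called the parameters of $X$. The second subconstituent $X_2$ of $X$ with respect to a vertex $v$ is the subgraph induced on the set of vertices at distance $2$ from $v$. It is known that $X_2$ is a connected regular graph of degree $k-c=q(q+c)$ on $\ell=k(k-1)/c$ vertices, and that the only numbers that can be eigenvalues of its adjacency matrix are $q(q+c)>q>-c>-(q+c)$. *)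

theory Defs
  imports "Graph_Theory.Graph_Theory" "Jordan_Normal_Form.Char_Poly"
begin

text \<open>
  The locale \<open>graph\<close> describes finite simple graphs, as symmetric digraphs without
  loops and without parallel arcs; the degree of a vertex is therefore its out-degree.
\<close>

definition common_neighbours :: "('a, 'b) pre_digraph \<Rightarrow> 'a \<Rightarrow> 'a \<Rightarrow> 'a set" where
  "common_neighbours G u v = {w \<in> verts G. u \<rightarrow>\<^bsub>G\<^esub> w \<and> v \<rightarrow>\<^bsub>G\<^esub> w}"

locale srnt_graph = graph G for G :: "('a, 'b) pre_digraph" (structure) +
  fixes k c :: nat
  assumes regular: "\<And>u. u \<in> verts G \<Longrightarrow> out_degree G u = k"
    and adjacent: "\<And>u v. u \<rightarrow>\<^bsub>G\<^esub> v \<Longrightarrow> common_neighbours G u v = {}"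
    and nonadjacent: "\<And>u v. u \<in> verts G \<Longrightarrow> v \<in> verts G \<Longrightarrow> u \<noteq> v \<Longrightarrow> \<not> u \<rightarrow>\<^bsub>G\<^esub> v
          \<Longrightarrow> card (common_neighbours G u v) = c"
    and k_ge_3: "3 \<le> k"
    and c_less_k: "c < k"
    and c_ge_1: "1 \<le> c"

text \<open>
  The parameter \<open>q\<close> is the larger root \<open>\<lambda>\<^sub>1\<close> of \<open>\<lambda>\<^sup>2 + c \<lambda> - (k - c) = 0\<close>.  That it is a
  positive integer is a theorem about such graphs, so it is taken as a real number
  here and integrality is not part of the definition.
\<close>

definition srnt_quadratic_roots :: "nat \<Rightarrow> nat \<Rightarrow> real set" where
  "srnt_quadratic_roots k c = {r. r\<^sup>2 + real c * r - (real k - real c) = 0}"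

definition srnt_with_parameters :: "('a, 'b) pre_digraph \<Rightarrow> real \<Rightarrow> nat \<Rightarrow> bool" where
  "srnt_with_parameters G q c \<longleftrightarrow>
     (\<exists>k. srnt_graph G k c \<and> q \<in> srnt_quadratic_roots k c \<and>
          (\<forall>r \<in> srnt_quadratic_roots k c. r \<le> q))"

text \<open>With unit weights, \<open>\<mu>\<close> is the usual graph distance.\<close>

definition second_subconstituent :: "('a, 'b) pre_digraph \<Rightarrow> 'a \<Rightarrow> ('a, 'b) pre_digraph" where
  "second_subconstituent G v = G \<restriction> {u \<in> verts G. wf_digraph.\<mu> G (\<lambda>_. 1) v u = 2}"

text \<open>The rows and columns are indexed by the positions in an enumeration \<open>vs\<close> of the vertices.\<close>

definition adjacency_matrix :: "('a, 'b) pre_digraph \<Rightarrow> 'a list \<Rightarrow> real mat" where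
  "adjacency_matrix G vs =
     mat (length vs) (length vs) (\<lambda>(i, j). if vs ! i \<rightarrow>\<^bsub>G\<^esub> vs ! j then 1 else 0)"

text \<open>Algebraic multiplicity; it is \<open>0\<close> when \<open>a\<close> is not an eigenvalue.\<close>

definition eigenvalue_multiplicity :: "'a :: field mat \<Rightarrow> 'a \<Rightarrow> nat" where
  "eigenvalue_multiplicity A a = order a (char_poly A)"

end

theory Submission
  imports Defs "Jordan_Normal_Form.Schur_Decomposition"
begin

text \<open>
  Let \<open>B\<close> be the adjacency matrix of \<open>X\<^sub>2\<close>.  Its eigenvalues all lie in
  \<open>{q (q + c), q, - c, - (q + c)}\<close>, where \<open>q (q + c) = k - c\<close>: the eigenvector argument of \<open>far_eigenvalue_cases\<close> derives this from
  the identity \<open>M\<^sup>2 = (k - c) I + c J - c M\<close> for the adjacency matrix \<open>M\<close> of \<open>X\<close>,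
  where \<open>J\<close> is the all-ones matrix
  (\<open>sum_two_step_walks\<close>).  Hence the trace of \<open>B ^ m\<close> is the sum of the \<open>m\<close>-th powers of these four
  numbers, weighted by their multiplicities (\<open>mat_trace_pow_eq_sum_multiplicity\<close>).

  On the other hand the traces for \<open>m = 0, 1, 2, 3\<close> can be counted (\<open>A_power_traces\<close>).  With
  \<open>l = k (k - 1) / c\<close> vertices, each of degree \<open>k - c\<close>, and no loops or triangles they are
  \<open>l, 0, l (k - c), 0\<close>.  The four numbers are distinct, so these four linear equations for the four
  multiplicities form a Vandermonde system with a unique solution (\<open>multiplicities_from_moments\<close>).
  The multiplicity \<open>1\<close> of \<open>q (q + c)\<close> comes out of the same system, so connectedness of \<open>X\<^sub>2\<close> is a
  consequence here rather than an ingredient.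
\<close>

section \<open>Traces of powers and eigenvalue multiplicities\<close>

definition mat_trace :: "'a :: comm_ring_1 mat \<Rightarrow> 'a" where
  "mat_trace A = (\<Sum>i<dim_row A. A $$ (i, i))"

lemma mat_trace_mult_comm:
  assumes "A \<in> carrier_mat n m" "B \<in> carrier_mat m n"
  shows "mat_trace (A * B) = mat_trace (B * A)"
proof -
  have "mat_trace (A * B) = (\<Sum>i<n. \<Sum>j<m. A $$ (i, j) * B $$ (j, i))"
    using assms by (auto simp: mat_trace_def scalar_prod_def atLeast0LessThan intro!: sum.cong)
  also have "\<dots> = (\<Sum>j<m. \<Sum>i<n. B $$ (j, i) * A $$ (i, j))"
    by (subst sum.swap) (simp add: mult.commute)
  also have "\<dots> = mat_trace (B * A)"
    using assms by (auto simp: mat_trace_def scalar_prod_def atLeast0LessThan intro!: sum.cong)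
  finally show ?thesis .
qed

lemma mat_trace_similar:
  assumes "similar_mat_wit A B P Q"
  shows "mat_trace A = mat_trace B"
proof -
  define n where "n = dim_row A"
  note w = similar_mat_witD[OF n_def assms]
  have "mat_trace A = mat_trace (P * (B * Q))" using w by (simp add: assoc_mult_mat)
  also have "\<dots> = mat_trace (B * Q * P)" using w by (intro mat_trace_mult_comm) auto
  also have "B * Q * P = B" using w by (simp add: assoc_mult_mat[of _ n n _ n _ n])
  finally show ?thesis .
qed

lemma upper_triangular_mult:
  fixes A B :: "'a :: comm_ring_1 mat"
  assumes A: "A \<in> carrier_mat n n" "upper_triangular A"
    and B: "B \<in> carrier_mat n n" "upper_triangular B"
  shows "upper_triangular (A * B)"
    and "i < n \<Longrightarrow> (A * B) $$ (i, i) = A $$ (i, i) * B $$ (i, i)"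
proof -
  have entry: "(A * B) $$ (i, j) = (\<Sum>t<n. A $$ (i, t) * B $$ (t, j))" if "i < n" "j < n" for i j
    using that A B by (auto simp: scalar_prod_def atLeast0LessThan)
  have A0: "A $$ (i, j) = 0" if "j < i" "i < n" for i j
    using that A by (auto intro: upper_triangularD)
  have B0: "B $$ (i, j) = 0" if "j < i" "i < n" for i j
    using that B by (auto intro: upper_triangularD)
  show "upper_triangular (A * B)"
  proof (rule upper_triangularI)
    fix i j assume *: "j < i" "i < dim_row (A * B)"
    have "A $$ (i, t) * B $$ (t, j) = 0" if "t < n" for t
      using that * A0[of t i] B0[of j t] A by (cases "t < i") auto
    then show "(A * B) $$ (i, j) = 0" using * A by (subst entry) auto
  qed
  show "(A * B) $$ (i, i) = A $$ (i, i) * B $$ (i, i)" if "i < n"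
  proof -
    have "(\<Sum>t<n. A $$ (i, t) * B $$ (t, i)) = (\<Sum>t\<in>{i}. A $$ (i, t) * B $$ (t, i))"
      using that A0 B0 by (intro sum.mono_neutral_right) (auto, metis linorder_neqE_nat mult_zero_left mult_zero_right)
    then show ?thesis using that by (simp add: entry)
  qed
qed

lemma upper_triangular_pow:
  fixes A :: "'a :: comm_ring_1 mat"
  assumes A: "A \<in> carrier_mat n n" "upper_triangular A"
  shows "upper_triangular (A ^\<^sub>m m) \<and> (\<forall>i<n. (A ^\<^sub>m m) $$ (i, i) = A $$ (i, i) ^ m)"
proof (induction m)
  case 0
  then show ?case using A by auto
next
  case (Suc m)
  have "A ^\<^sub>m m \<in> carrier_mat n n" using A by simp
  from upper_triangular_mult[OF this _ A] Suc show ?case by (simp add: mult.commute)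
qed

text \<open>
  A Schur triangularization \<open>A = P * B * Q\<close> carries over to powers, trace is a similarity invariant,
  and the diagonal of \<open>B\<close> consists of the roots of the characteristic polynomial.
\<close>

lemma mat_trace_pow_eq_sum_list:
  fixes A :: "complex mat"
  assumes A: "A \<in> carrier_mat n n" and cp: "char_poly A = (\<Prod>a\<leftarrow>as. [:- a, 1:])"
  shows "mat_trace (A ^\<^sub>m m) = (\<Sum>a\<leftarrow>as. a ^ m)"
proof -
  obtain B P Q where dec: "schur_decomposition A as = (B, P, Q)"
    by (cases "schur_decomposition A as") auto
  from schur_decomposition[OF A cp dec]
  have sim: "similar_mat_wit A B P Q" and B: "upper_triangular B" and diag: "diag_mat B = as" by auto
  have Bc: "B \<in> carrier_mat n n" using similar_mat_witD2[OF A sim] by auto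
  have "mat_trace (A ^\<^sub>m m) = mat_trace (B ^\<^sub>m m)"
    by (rule mat_trace_similar[OF similar_mat_wit_pow[OF sim]])
  also have "\<dots> = (\<Sum>i<n. (B $$ (i, i)) ^ m)"
    using upper_triangular_pow[OF Bc B, of m] Bc by (simp add: mat_trace_def)
  also have "\<dots> = (\<Sum>a\<leftarrow>diag_mat B. a ^ m)"
    using Bc by (simp add: diag_mat_def o_def sum_list_sum_nth atLeast0LessThan)
  finally show ?thesis by (simp add: diag)
qed

lemma sum_list_eq_sum_count_list:
  fixes f :: "'a \<Rightarrow> 'b :: comm_ring_1"
  assumes "finite T" "set as \<subseteq> T"
  shows "(\<Sum>a\<leftarrow>as. f a) = (\<Sum>a\<in>T. of_nat (count_list as a) * f a)"
  using assms(2)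
proof (induction as)
  case (Cons b as)
  have "(\<Sum>a\<in>T. of_nat (count_list (b # as) a) * f a)
      = (\<Sum>a\<in>T. (if a = b then f a else 0) + of_nat (count_list as a) * f a)"
    by (rule sum.cong) (auto simp: algebra_simps)
  also have "\<dots> = f b + (\<Sum>a\<in>T. of_nat (count_list as a) * f a)"
    using assms(1) Cons.prems by (simp add: sum.distrib)
  finally show ?case using Cons by simp
qed simp

lemma order_prod_linear_factors:
  fixes a :: "'a :: field"
  shows "Polynomial.order a (\<Prod>b\<leftarrow>as. [:- b, 1:]) = count_list as a"
proof (induction as)
  case (Cons b as)
  have "(\<Prod>b\<leftarrow>as. [:- b, 1:]) \<noteq> 0" by (auto simp: prod_list_zero_iff)
  then have "Polynomial.order a (\<Prod>b\<leftarrow>b # as. [:- b, 1:]) = Polynomial.order a [:- b, 1:] + count_list as a"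
    using Cons by (simp add: order_mult del: mult_pCons_left)
  moreover have "Polynomial.order a [:- b, 1:] = (if a = b then 1 else 0)"
    using order_power_n_n[of b 1] by (auto simp: order_0I)
  ultimately show ?case by simp
qed simp

interpretation of_real_complex_poly: map_poly_inj_idom_divide_hom complex_of_real ..

text \<open>
  The eigenvalue hypothesis is about the complexified matrix because only there does the
  characteristic polynomial split without further argument; once all its roots are known to be real,
  orders of roots transfer back along the injection of the reals.
\<close>

lemma mat_trace_pow_eq_sum_multiplicity:
  fixes A :: "real mat"
  assumes A: "A \<in> carrier_mat n n" and S: "finite S"
    and ev: "\<And>e. eigenvalue (map_mat complex_of_real A) e \<Longrightarrow> e \<in> complex_of_real ` S"
  shows "mat_trace (A ^\<^sub>m m) = (\<Sum>a\<in>S. real (eigenvalue_multiplicity A a) * a ^ m)"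
proof -
  let ?C = "map_mat complex_of_real A"
  have C: "?C \<in> carrier_mat n n" using A by simp
  from char_poly_factorized[OF C] obtain as where as: "char_poly ?C = (\<Prod>a\<leftarrow>as. [:- a, 1:])"
    by blast
  have sub: "set as \<subseteq> complex_of_real ` S"
  proof
    fix a assume "a \<in> set as"
    then have "poly (char_poly ?C) a = 0" unfolding as by (rule linear_poly_root)
    then show "a \<in> complex_of_real ` S" using ev eigenvalue_root_char_poly[OF C] by blast
  qed
  have mult: "count_list as (complex_of_real a) = eigenvalue_multiplicity A a" for a
    by (simp add: eigenvalue_multiplicity_def order_prod_linear_factors[symmetric] as[symmetric]
        of_real_hom.char_poly_hom[OF A] of_real_complex_poly.order_hom)
  have "complex_of_real (mat_trace (A ^\<^sub>m m)) = mat_trace (?C ^\<^sub>m m)"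
    using A by (simp add: mat_trace_def of_real_hom.mat_hom_pow[OF A, symmetric])
  also have "\<dots> = (\<Sum>a\<leftarrow>as. a ^ m)" by (rule mat_trace_pow_eq_sum_list[OF C as])
  also have "\<dots> = (\<Sum>a\<in>complex_of_real ` S. of_nat (count_list as a) * a ^ m)"
    using S sub by (intro sum_list_eq_sum_count_list) auto
  also have "\<dots> = (\<Sum>a\<in>S. of_nat (eigenvalue_multiplicity A a) * complex_of_real a ^ m)"
    by (subst sum.reindex) (auto simp: inj_on_def mult)
  also have "\<dots> = complex_of_real (\<Sum>a\<in>S. real (eigenvalue_multiplicity A a) * a ^ m)"
    by simp
  finally show ?thesis by (simp only: of_real_eq_iff)
qed

section \<open>Recovering the multiplicities from four moments\<close>

text \<open>
  Pairing the moments with the polynomial \<open>(t - b) (t - d) (t - e)\<close> kills three of the four nodes;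
  this is one row of the inverted Vandermonde system, up to scaling.
\<close>

lemma isolate_weight:
  fixes a b d e :: "'r :: comm_ring_1"
  assumes "w + x + y + z = t0"
    and "w * a + x * b + y * d + z * e = t1"
    and "w * a^2 + x * b^2 + y * d^2 + z * e^2 = t2"
    and "w * a^3 + x * b^3 + y * d^3 + z * e^3 = t3"
  shows "w * ((a - b) * (a - d) * (a - e))
    = t3 - (b + d + e) * t2 + (b * d + b * e + d * e) * t1 - b * d * e * t0"
  unfolding assms[symmetric] by (simp add: algebra_simps power2_eq_square power3_eq_cube)

text \<open>
  The nodes are distinct, so the four moments determine the four weights.  Each weight is isolated
  by the polynomial vanishing at the other three nodes; what then remains is to cancel a product
  of nonzero factors, using \<open>k - 1 = (q + 1) (q + c - 1)\<close>.
\<close>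

lemma multiplicities_from_moments:
  fixes q c k l w x y z :: real
  assumes pos: "q > 0" "c \<ge> 1"
    and k: "k = q * (q + c) + c"
    and l: "c * l = k * (k - 1)"
    and m0: "w + x + y + z = l"
    and m1: "w * (q * (q + c)) + x * q + y * - c + z * - (q + c) = 0"
    and m2: "w * (q * (q + c))^2 + x * q^2 + y * (- c)^2 + z * (- (q + c))^2 = l * (q * (q + c))"
    and m3: "w * (q * (q + c))^3 + x * q^3 + y * (- c)^3 + z * (- (q + c))^3 = 0"
  shows "w = 1"
    and "x = (q + 1) * (q^2 + q * c + c) * (q^2 + 2 * q * c + c^2 - 2 * c - q) / (c * (c + 2 * q))"
    and "y = q^2 + q * c + c - 1"
    and "z = (q + c - 1) * (q^2 + q * c + c) * (q^2 + q - c) / (c * (c + 2 * q))"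
proof -
  have nz: "q \<noteq> 0" "c \<noteq> 0" "q + c \<noteq> 0" "q + c - 1 \<noteq> 0" "c + 2 * q \<noteq> 0" "q + 1 \<noteq> 0"
    "q * (q + c) + c \<noteq> 0"
    using pos by (auto simp: add_nonneg_eq_0_iff)
  have k1: "k - 1 = (q + 1) * (q + c - 1)" unfolding k by (simp add: algebra_simps)
  note m = m0 m1 m2 m3
  have "w * (((q * (q + c)) - q) * ((q * (q + c)) - (- c)) * ((q * (q + c)) - (- (q + c))))
    = 0 - (q + (- c) + (- (q + c))) * (l * (q * (q + c))) + (q * (- c) + q * (- (q + c)) + (- c) * (- (q + c))) * 0
      - q * (- c) * (- (q + c)) * l"
    by (rule isolate_weight[where x = x and y = y and z = z]) (use m in linarith)+
  then have "w * ((q*(q+c) - q) * (q*(q+c) - - c) * (q*(q+c) - -(q+c))) = q * (q + c) * (c * l)"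
    by Groebner_Basis.algebra
  then have "(q * (q + c) * (q * (q + c) + c) * ((q + 1) * (q + c - 1))) * (w - 1) = 0"
    unfolding l k1 k by Groebner_Basis.algebra
  then show "w = 1" using nz by simp
  have "x * ((q - (q * (q + c))) * (q - (- c)) * (q - (- (q + c))))
    = 0 - ((q * (q + c)) + (- c) + (- (q + c))) * (l * (q * (q + c))) + ((q * (q + c)) * (- c) + (q * (q + c)) * (- (q + c)) + (- c) * (- (q + c))) * 0
      - (q * (q + c)) * (- c) * (- (q + c)) * l"
    by (rule isolate_weight[where x = w and y = y and z = z]) (use m in linarith)+
  then have "x * ((q - q*(q+c)) * (q - - c) * (q - -(q+c))) = (2 * c + q - q * (q + c) - c * (q + c)) * (q * (q + c)) * l"
    by Groebner_Basis.algebra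
  then have "x * c * ((q - q*(q+c)) * (q - - c) * (q - -(q+c))) = (2 * c + q - q * (q + c) - c * (q + c)) * (q * (q + c)) * (c * l)"
    by Groebner_Basis.algebra
  then have "(q * (q + c - 1) * (q + c)) * (x * (c * (c + 2 * q))
       - (q + 1) * (q^2 + q * c + c) * (q^2 + 2 * q * c + c^2 - 2 * c - q)) = 0"
    unfolding l k1 k by Groebner_Basis.algebra
  then show "x = (q + 1) * (q^2 + q * c + c) * (q^2 + 2 * q * c + c^2 - 2 * c - q) / (c * (c + 2 * q))"
    using nz by (simp add: eq_divide_eq)
  have "y * (((- c) - (q * (q + c))) * ((- c) - q) * ((- c) - (- (q + c))))
    = 0 - ((q * (q + c)) + q + (- (q + c))) * (l * (q * (q + c))) + ((q * (q + c)) * q + (q * (q + c)) * (- (q + c)) + q * (- (q + c))) * 0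
      - (q * (q + c)) * q * (- (q + c)) * l"
    by (rule isolate_weight[where x = w and y = x and z = z]) (use m in linarith)+
  then have "y * ((- c - q*(q+c)) * (- c - q) * (- c - -(q+c))) = q * (q + c) * (c * l)"
    by Groebner_Basis.algebra
  then have "(q * (q + c) * (q * (q + c) + c)) * (y - (q^2 + q * c + c - 1)) = 0"
    unfolding l k by Groebner_Basis.algebra
  then show "y = q^2 + q * c + c - 1" using nz by simp
  have "z * (((- (q + c)) - (q * (q + c))) * ((- (q + c)) - q) * ((- (q + c)) - (- c)))
    = 0 - ((q * (q + c)) + q + (- c)) * (l * (q * (q + c))) + ((q * (q + c)) * q + (q * (q + c)) * (- c) + q * (- c)) * 0
      - (q * (q + c)) * q * (- c) * l"
    by (rule isolate_weight[where x = w and y = x and z = y]) (use m in linarith)+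
  then have "z * ((- (q+c) - q*(q+c)) * (- (q+c) - q) * (- (q+c) - - c)) = (c - q - q * (q + c) + c * q) * (q * (q + c)) * l"
    by Groebner_Basis.algebra
  then have "z * c * ((- (q+c) - q*(q+c)) * (- (q+c) - q) * (- (q+c) - - c)) = (c - q - q * (q + c) + c * q) * (q * (q + c)) * (c * l)"
    by Groebner_Basis.algebra
  then have "(q * (q + c) * (q + 1)) * (z * (c * (c + 2 * q))
       - (q + c - 1) * (q^2 + q * c + c) * (q^2 + q - c)) = 0"
    unfolding l k1 k by Groebner_Basis.algebra
  then show "z = (q + c - 1) * (q^2 + q * c + c) * (q^2 + q - c) / (c * (c + 2 * q))"
    using nz by (simp add: eq_divide_eq)
qed

section \<open>Vertices at distance two\<close>

context srnt_graph
begin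

text \<open>The ring is left open because traces live over the reals and eigenvectors over the complex numbers.\<close>

abbreviation adj :: "'a \<Rightarrow> 'a \<Rightarrow> 'r :: comm_ring_1" where
  "adj u w \<equiv> of_bool (u \<rightarrow> w)"

lemma adj_sym: "u \<rightarrow> w \<longleftrightarrow> w \<rightarrow> u"
  using arcs_ends_symmetric[OF sym_arcs] by blast

lemma not_adj_self: "\<not> u \<rightarrow> u"
  using no_loops by (auto simp: arcs_ends_conv)

lemma card_neighbours:
  assumes "u \<in> verts G"
  shows "card {w \<in> verts G. u \<rightarrow> w} = k"
proof -
  have "{w \<in> verts G. u \<rightarrow> w} = head G ` out_arcs G u"
    by (auto simp: arcs_ends_conv)
  moreover have "inj_on (head G) (out_arcs G u)"
    by (rule inj_onI) (auto intro!: no_multi_arcs simp: arc_to_ends_def)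
  ultimately have "card {w \<in> verts G. u \<rightarrow> w} = out_degree G u"
    by (simp add: card_image out_degree_def)
  then show ?thesis using regular[OF assms] by simp
qed

text \<open>
  Distance \<open>2\<close> is attained by every non-adjacent pair because \<open>c\<close> is positive, so that there is a
  common neighbour in between.
\<close>

lemma \<mu>_eq_2_iff:
  assumes "u \<in> verts G" "v \<in> verts G"
  shows "\<mu> (\<lambda>_. 1) v u = 2 \<longleftrightarrow> u \<noteq> v \<and> \<not> v \<rightarrow> u"
proof -
  have cost: "awalk_cost (\<lambda>_. 1) p = real (length p)" for p :: "'b list"
    by (induction p) auto
  have lower: "2 \<le> \<mu> (\<lambda>_. 1) v u" if "u \<noteq> v" "\<not> v \<rightarrow> u"
    unfolding \<mu>_def
  proof (rule INF_greatest)
    fix p assume "p \<in> {p. awalk v p u}"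
    then have p: "awalk v p u" by simp
    have "p \<noteq> []" using p that by (auto simp: awalk_Nil_iff)
    moreover have "p \<noteq> [e]" for e
      using p that by (auto simp: awalk_Cons_iff awalk_Nil_iff arcs_ends_conv)
    ultimately have "2 \<le> length p" by (cases p; cases "tl p") auto
    then show "2 \<le> ereal (awalk_cost (\<lambda>_. 1) p)" by (simp add: cost)
  qed
  have upper: "\<mu> (\<lambda>_. 1) v u \<le> 2" if "u \<noteq> v" "\<not> v \<rightarrow> u"
  proof -
    have "card (common_neighbours G v u) \<noteq> 0"
      using nonadjacent[OF assms(2,1)] that c_ge_1 by auto
    then obtain w where "v \<rightarrow> w" "u \<rightarrow> w"
      unfolding common_neighbours_def by (metis (no_types, lifting) Collect_empty_eq card.empty)
    then have "(v, w) \<in> arcs_ends G" "(w, u) \<in> arcs_ends G" using adj_sym by auto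
    then obtain e e' where "e \<in> arcs G" "tail G e = v" "head G e = w"
      "e' \<in> arcs G" "tail G e' = w" "head G e' = u"
      by (auto simp: arcs_ends_conv)
    then have "awalk v [e, e'] u" using assms by (simp add: awalk_Cons_iff awalk_Nil_iff)
    from min_cost_le_walk_cost[OF this, of "\<lambda>_. 1"] show ?thesis by (simp add: cost)
  qed
  have "\<mu> (\<lambda>_. 1) v u \<le> 0" if "u = v"
  proof -
    have "awalk v [] u" using that assms by (simp add: awalk_Nil_iff)
    from min_cost_le_walk_cost[OF this, of "\<lambda>_. 1"] show ?thesis by (simp add: zero_ereal_def)
  qed
  moreover have "\<mu> (\<lambda>_. 1) v u \<le> 1" if "v \<rightarrow> u"
  proof -
    from that obtain e where "e \<in> arcs G" "tail G e = v" "head G e = u"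
      by (auto simp: arcs_ends_conv)
    then have "awalk v [e] u" using assms by (simp add: awalk_Cons_iff awalk_Nil_iff)
    from min_cost_le_walk_cost[OF this, of "\<lambda>_. 1"] show ?thesis by (simp add: one_ereal_def)
  qed
  ultimately show ?thesis using lower upper by (auto simp: not_le[symmetric])
qed

text \<open>The defining matrix identity \<open>M\<^sup>2 = (k - c) I + c J - c M\<close> of the adjacency matrix \<open>M\<close>, entry by entry.\<close>

lemma sum_two_step_walks:
  assumes "u \<in> verts G" "t \<in> verts G"
  shows "(\<Sum>w\<in>verts G. adj u w * adj w t)
    = (of_nat k - of_nat c) * of_bool (u = t) + of_nat c - of_nat c * (adj u t :: 'r :: comm_ring_1)"
proof -
  have "(\<Sum>w\<in>verts G. adj u w * adj w t)
      = (\<Sum>w\<in>verts G. of_bool (u \<rightarrow> w \<and> t \<rightarrow> w) :: 'r)"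
    using adj_sym[of _ t] by (intro sum.cong) auto
  also have "\<dots> = of_nat (card (common_neighbours G u t))"
    by (simp add: common_neighbours_def Int_def)
  also have "card (common_neighbours G u t) = (if u = t then k else if u \<rightarrow> t then 0 else c)"
  proof -
    have "common_neighbours G u u = {w \<in> verts G. u \<rightarrow> w}" by (simp add: common_neighbours_def)
    then show ?thesis
      using card_neighbours[OF assms(1)] adjacent[of u t] nonadjacent[OF assms]
      by (cases "u = t") simp_all
  qed
  finally show ?thesis using not_adj_self by auto
qed

text \<open>The vertex set of the second subconstituent, described without distances.\<close>

definition far_verts :: "'a \<Rightarrow> 'a set" where
  "far_verts v = {u \<in> verts G. u \<noteq> v \<and> \<not> v \<rightarrow> u}"

lemma far_verts_in_verts: "u \<in> far_verts v \<Longrightarrow> u \<in> verts G"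
  by (simp add: far_verts_def)

lemma finite_far_verts [simp]: "finite (far_verts v)"
  by (simp add: far_verts_def)

text \<open>The vertices split into \<open>v\<close>, its neighbours and the rest.\<close>

lemma sum_far_verts:
  fixes f :: "'a \<Rightarrow> 'r :: comm_ring_1"
  assumes "v \<in> verts G"
  shows "(\<Sum>u\<in>far_verts v. f u) = (\<Sum>u\<in>verts G. f u) - f v - (\<Sum>u\<in>verts G. adj v u * f u)"
proof -
  have "(\<Sum>u\<in>verts G. f u)
      = (\<Sum>u\<in>verts G. of_bool (u = v) * f u + adj v u * f u + of_bool (u \<in> far_verts v) * f u)"
    using not_adj_self by (intro sum.cong) (auto simp: far_verts_def)
  also have "\<dots> = f v + (\<Sum>u\<in>verts G. adj v u * f u) + (\<Sum>u\<in>verts G. of_bool (u \<in> far_verts v) * f u)"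
    using assms by (simp add: sum.distrib)
  also have "(\<Sum>u\<in>verts G. of_bool (u \<in> far_verts v) * f u) = (\<Sum>u\<in>far_verts v. f u)"
    by (rule sum.mono_neutral_cong_right) (auto simp: far_verts_def)
  finally show ?thesis by simp
qed

lemma sum_neighbours:
  assumes "u \<in> verts G"
  shows "(\<Sum>w\<in>verts G. adj u w) = (of_nat k :: 'r :: comm_ring_1)"
  using card_neighbours[OF assms] by (simp add: Int_def)

text \<open>Of the \<open>k\<close> neighbours of \<open>u\<close>, exactly the \<open>c\<close> common neighbours with \<open>v\<close> lie outside.\<close>

lemma far_degree:
  assumes "v \<in> verts G" "u \<in> far_verts v"
  shows "(\<Sum>w\<in>far_verts v. adj u w) = (of_nat k - of_nat c :: 'r :: comm_ring_1)"
proof -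
  have u: "u \<in> verts G" "v \<noteq> u" "\<not> v \<rightarrow> u" "\<not> u \<rightarrow> v"
    using assms adj_sym by (auto simp: far_verts_def)
  have "(\<Sum>w\<in>verts G. adj v w * adj u w) = (of_nat c :: 'r)"
    using sum_two_step_walks[OF assms(1) u(1)] u adj_sym[of u] by simp
  then show ?thesis
    using sum_far_verts[OF assms(1), of "\<lambda>w. adj u w :: 'r"] u sum_neighbours[OF u(1)]
    by simp
qed

text \<open>
  Summing the identity for \<open>M\<^sup>2\<close> over the row of \<open>v\<close> counts the two-step walks from \<open>v\<close>, of which
  there are \<open>k\<^sup>2\<close>; this gives the number of vertices.
\<close>

lemma card_far_verts:
  assumes "v \<in> verts G"
  shows "real c * real (card (far_verts v)) = real k * (real k - 1)"
proof -
  define n where "n = real (card (verts G))"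
  have "real k * real k = (\<Sum>w\<in>verts G. adj v w * real k)"
    using sum_neighbours[OF assms, where 'r = real] by (simp flip: sum_distrib_right)
  also have "\<dots> = (\<Sum>w\<in>verts G. adj v w * (\<Sum>t\<in>verts G. adj w t))"
    by (rule sum.cong) (simp_all only: sum_neighbours)
  also have "\<dots> = (\<Sum>t\<in>verts G. \<Sum>w\<in>verts G. adj v w * adj w t)"
    by (simp only: sum_distrib_left) (rule sum.swap)
  also have "\<dots> = (\<Sum>t\<in>verts G. (real k - real c) * of_bool (v = t) + real c - real c * adj v t)"
    by (rule sum.cong) (simp_all only: sum_two_step_walks[OF assms])
  also have "\<dots> = (real k - real c) + real c * n - real c * real k"
    using assms sum_neighbours[OF assms, where 'r = real]
    by (simp add: sum.distrib sum_subtractf n_def flip: sum_distrib_left)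
  finally have "real k * real k = (real k - real c) + real c * n - real c * real k" .
  then have walks: "real c * (n - 1 - real k) = real k * (real k - 1)"
    by (simp add: algebra_simps)
  have card: "real (card (far_verts v)) = n - 1 - real k"
    using sum_far_verts[OF assms, of "\<lambda>_. 1 :: real"] sum_neighbours[OF assms, where 'r = real]
    by (simp add: n_def)
  show ?thesis unfolding card by (rule walks)
qed

text \<open>
  Let \<open>r \<noteq> k - c\<close>.  Regularity makes the coordinates of \<open>x\<close> sum to \<open>0\<close>.  Extend \<open>x\<close> by \<open>0\<close> to the
  whole graph and let \<open>y = M x\<close>, which is \<open>r x\<close> at distance \<open>2\<close> from \<open>v\<close>.  Then \<open>M\<^sup>2 x = (k - c) x - c y\<close>.
  At a neighbour \<open>u\<close> of \<open>v\<close> no neighbour of \<open>u\<close> is a neighbour of \<open>v\<close>, so \<open>(M y) u = r y u\<close> and hence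
  \<open>(r + c) y u = 0\<close>.  Unless \<open>r = - c\<close>, \<open>y\<close> therefore vanishes on the neighbours of \<open>v\<close>; then
  \<open>M y = r\<^sup>2 x\<close> at distance \<open>2\<close>, and the quadratic equation follows.
\<close>

lemma far_eigenvalue_cases:
  fixes x :: "'a \<Rightarrow> complex" and r :: complex
  assumes v: "v \<in> verts G"
    and eig: "\<And>u. u \<in> far_verts v \<Longrightarrow> (\<Sum>w\<in>far_verts v. adj u w * x w) = r * x u"
    and nonzero: "u0 \<in> far_verts v" "x u0 \<noteq> 0"
  shows "r = of_nat k - of_nat c \<or> r = - of_nat c \<or> r\<^sup>2 + of_nat c * r - (of_nat k - of_nat c) = 0"
proof (rule ccontr)
  assume *: "\<not> ?thesis"
  let ?S = "far_verts v"
  let ?s = "\<Sum>w\<in>?S. x w"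
  let ?y = "\<lambda>u. \<Sum>w\<in>?S. adj u w * x w"
  have "r * ?s = (\<Sum>u\<in>?S. ?y u)" by (simp only: eig sum_distrib_left cong: sum.cong)
  also have "\<dots> = (\<Sum>w\<in>?S. \<Sum>u\<in>?S. adj w u * x w)"
    by (subst sum.swap) (rule sum.cong[OF refl], rule sum.cong[OF refl], simp add: adj_sym[of w u for u w])
  also have "\<dots> = (\<Sum>w\<in>?S. (of_nat k - of_nat c) * x w)"
    by (rule sum.cong) (simp_all only: far_degree[OF v] flip: sum_distrib_right)
  also have "\<dots> = (of_nat k - of_nat c) * ?s" by (simp add: sum_distrib_left)
  finally have s0: "?s = 0" using * by auto
  \<comment> \<open>the identity for \<open>M\<^sup>2\<close> applied to \<open>x\<close>\<close>
  have two: "(\<Sum>t\<in>verts G. adj u t * ?y t)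
      = (of_nat k - of_nat c) * (of_bool (u \<in> ?S) * x u) - of_nat c * ?y u"
    if u: "u \<in> verts G" for u
  proof -
    have "(\<Sum>t\<in>verts G. adj u t * ?y t)
       = (\<Sum>w\<in>?S. (\<Sum>t\<in>verts G. adj u t * adj t w) * x w)"
      by (simp only: sum_distrib_left sum_distrib_right mult.assoc) (rule sum.swap)
    also have "\<dots> = (\<Sum>w\<in>?S. (of_nat k - of_nat c) * (of_bool (u = w) * x w) + of_nat c * x w
        - of_nat c * (adj u w * x w))"
    proof (rule sum.cong[OF refl])
      fix w assume "w \<in> ?S"
      then have "w \<in> verts G" by (rule far_verts_in_verts)
      show "(\<Sum>t\<in>verts G. adj u t * adj t w) * x w = (of_nat k - of_nat c) * (of_bool (u = w) * x w)
          + of_nat c * x w - of_nat c * (adj u w * x w)"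
        unfolding sum_two_step_walks[OF u \<open>w \<in> verts G\<close>] by (simp only: algebra_simps)
    qed
    also have "\<dots> = (of_nat k - of_nat c) * (\<Sum>w\<in>?S. of_bool (u = w) * x w) + of_nat c * ?s - of_nat c * ?y u"
      by (simp only: sum.distrib sum_subtractf sum_distrib_left)
    also have "(\<Sum>w\<in>?S. of_bool (u = w) * x w) = of_bool (u \<in> ?S) * x u"
      by simp
    finally show ?thesis using s0 by simp
  qed
  \<comment> \<open>\<open>M y\<close>, separated into the neighbours of \<open>v\<close> and the vertices at distance \<open>2\<close>\<close>
  have split: "(\<Sum>t\<in>verts G. adj u t * ?y t)
      = (\<Sum>t\<in>verts G. adj v t * (adj u t * ?y t)) + r * ?y u"
    if u: "u \<in> verts G" for u
  proof -
    have yv: "?y v = 0" by (rule sum.neutral) (auto simp: far_verts_def)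
    have "(\<Sum>t\<in>?S. adj u t * ?y t) = r * ?y u"
      by (simp only: eig sum_distrib_left mult.left_commute cong: sum.cong)
    then show ?thesis using sum_far_verts[OF v, of "\<lambda>t. adj u t * ?y t"] yv
      by (simp add: algebra_simps)
  qed
  have ynbr: "?y u = 0" if u: "v \<rightarrow> u" for u
  proof -
    have uV: "u \<in> verts G" using u adj_in_verts by blast
    have "adj v t * (adj u t * ?y t) = 0" if "t \<in> verts G" for t
      using adjacent[OF u] that by (auto simp: common_neighbours_def)
    then have "r * ?y u = - of_nat c * ?y u"
      using split[OF uV] two[OF uV] u by (simp add: far_verts_def)
    then have "(r + of_nat c) * ?y u = 0" by (simp add: algebra_simps)
    then show ?thesis using * by (simp add: eq_neg_iff_add_eq_0)
  qed
  have u0: "u0 \<in> verts G" using nonzero far_verts_in_verts by blast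
  have "(\<Sum>t\<in>verts G. adj v t * (adj u0 t * ?y t)) = 0"
    by (rule sum.neutral) (use ynbr in auto)
  then have "(r\<^sup>2 + of_nat c * r - (of_nat k - of_nat c)) * x u0 = 0"
    using split[OF u0] two[OF u0] nonzero eig[OF nonzero(1)]
    by (simp add: algebra_simps power2_eq_square)
  then show False using * nonzero by simp
qed

section \<open>The adjacency matrix of the second subconstituent\<close>

lemma verts_second_subconstituent:
  assumes "v \<in> verts G"
  shows "verts (second_subconstituent G v) = far_verts v"
  using \<mu>_eq_2_iff[OF _ assms] by (auto simp: second_subconstituent_def far_verts_def)

lemma second_subconstituent_adj_iff:
  assumes "v \<in> verts G" "u \<in> far_verts v" "w \<in> far_verts v"
  shows "u \<rightarrow>\<^bsub>second_subconstituent G v\<^esub> w \<longleftrightarrow> u \<rightarrow> w"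
proof -
  have "second_subconstituent G v = G \<restriction> far_verts v"
    using verts_second_subconstituent[OF assms(1)] by (simp add: second_subconstituent_def)
  then show ?thesis using assms(2,3) by (auto simp: arcs_ends_conv)
qed

context
  fixes v vs and A :: "real mat"
  assumes v: "v \<in> verts G" and dist: "distinct vs"
    and set_vs: "set vs = verts (second_subconstituent G v)"
    and A_def: "A = adjacency_matrix (second_subconstituent G v) vs"
begin

lemma set_vs_far: "set vs = far_verts v"
  using set_vs verts_second_subconstituent[OF v] by simp

lemma nth_far: "i < length vs \<Longrightarrow> vs ! i \<in> far_verts v"
  using set_vs_far nth_mem by blast

lemma A_carrier: "A \<in> carrier_mat (length vs) (length vs)"
  by (simp add: A_def adjacency_matrix_def)

lemma A_entry:
  assumes "i < length vs" "j < length vs"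
  shows "A $$ (i, j) = adj (vs ! i) (vs ! j)"
  using assms second_subconstituent_adj_iff[OF v nth_far nth_far]
  by (simp add: A_def adjacency_matrix_def)

lemma sum_positions:
  fixes f :: "'a \<Rightarrow> 'r :: comm_ring_1"
  shows "(\<Sum>i<length vs. f (vs ! i)) = (\<Sum>u\<in>far_verts v. f u)"
  using sum.reindex_bij_betw[OF bij_betw_nth[OF dist refl set_vs_far[symmetric]]] .

lemma eigenvalue_cases:
  assumes "eigenvalue (map_mat complex_of_real A) r"
  shows "r = of_nat k - of_nat c \<or> r = - of_nat c \<or> r\<^sup>2 + of_nat c * r - (of_nat k - of_nat c) = 0"
proof -
  let ?l = "length vs"
  obtain z where z: "z \<in> carrier_vec ?l" "z \<noteq> 0\<^sub>v ?l" "map_mat complex_of_real A *\<^sub>v z = r \<cdot>\<^sub>v z"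
    using assms A_carrier by (auto simp: eigenvalue_def eigenvector_def)
  define x where "x u = z $ (inv_into {..<?l} ((!) vs) u)" for u
  have inj: "inj_on ((!) vs) {..<?l}"
    using dist by (simp add: inj_on_nth)
  have x: "x (vs ! i) = z $ i" if "i < ?l" for i
    using inj that by (simp add: x_def inv_into_f_f)
  have eig: "(\<Sum>w\<in>far_verts v. adj u w * x w) = r * x u" if u: "u \<in> far_verts v" for u
  proof -
    obtain i where i: "i < ?l" "vs ! i = u"
      using u set_vs_far by (metis in_set_conv_nth)
    have "(\<Sum>w\<in>far_verts v. adj u w * x w) = (\<Sum>j<?l. adj (vs ! i) (vs ! j) * x (vs ! j))"
      unfolding i(2) by (rule sum_positions[of "\<lambda>w. adj u w * x w", symmetric])
    also have "\<dots> = (\<Sum>j<?l. complex_of_real (A $$ (i, j)) * z $ j)"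
      by (rule sum.cong) (simp_all add: A_entry i(1) x)
    also have "\<dots> = (map_mat complex_of_real A *\<^sub>v z) $ i"
      using A_carrier z(1) i(1) by (auto simp: scalar_prod_def atLeast0LessThan intro!: sum.cong)
    also have "\<dots> = r * x u" using z i x[OF i(1)] by simp
    finally show ?thesis .
  qed
  obtain i where "i < ?l" "z $ i \<noteq> 0"
    using z(1,2) by (metis eq_vecI carrier_vecD index_zero_vec)
  then have "vs ! i \<in> far_verts v" "x (vs ! i) \<noteq> 0" using nth_far x by auto
  with far_eigenvalue_cases[OF v eig] show ?thesis by blast
qed

text \<open>
  Traces count closed walks: there are no loops, closed walks of length \<open>2\<close> run along an edge and
  back, and closed walks of length \<open>3\<close> are triangles.
\<close>

lemma A_power_traces:
  shows "mat_trace (A ^\<^sub>m 0) = real (card (far_verts v))"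
    and "mat_trace (A ^\<^sub>m 1) = 0"
    and "mat_trace (A ^\<^sub>m 2) = real (card (far_verts v)) * (real k - real c)"
    and "mat_trace (A ^\<^sub>m 3) = 0"
proof -
  let ?l = "length vs"
  have l: "?l = card (far_verts v)"
    using distinct_card[OF dist] set_vs_far by simp
  have dim [simp]: "dim_row A = ?l" "dim_col A = ?l" using A_carrier by auto
  have pow: "A ^\<^sub>m 1 = A" "A ^\<^sub>m 2 = A * A" "A ^\<^sub>m 3 = A * A * A"
    using A_carrier by (simp_all add: numeral_2_eq_2 numeral_3_eq_3)
  show "mat_trace (A ^\<^sub>m 0) = real (card (far_verts v))"
    by (simp add: mat_trace_def l)
  show "mat_trace (A ^\<^sub>m 1) = 0"
    unfolding pow by (simp add: mat_trace_def A_entry not_adj_self)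
  have sq: "(A * A) $$ (i, j) = (\<Sum>w\<in>far_verts v. adj (vs ! i) w * adj w (vs ! j))"
    if "i < ?l" "j < ?l" for i j
  proof -
    have "(A * A) $$ (i, j) = (\<Sum>t<?l. adj (vs ! i) (vs ! t) * adj (vs ! t) (vs ! j))"
      using that by (simp add: scalar_prod_def atLeast0LessThan A_entry)
    then show ?thesis
      using sum_positions[of "\<lambda>w. adj (vs ! i) w * adj w (vs ! j) :: real"] by simp
  qed
  have "(A * A) $$ (i, i) = real k - real c" if "i < ?l" for i
  proof -
    have "(A * A) $$ (i, i) = (\<Sum>w\<in>far_verts v. adj (vs ! i) w)"
      unfolding sq[OF that that] using adj_sym[of _ "vs ! i"] by (intro sum.cong) auto
    then show ?thesis using far_degree[OF v nth_far[OF that], where 'r = real] by simp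
  qed
  then show "mat_trace (A ^\<^sub>m 2) = real (card (far_verts v)) * (real k - real c)"
    unfolding pow by (simp add: mat_trace_def l)
  have "(A * A) $$ (i, j) * A $$ (j, i) = 0" if "i < ?l" "j < ?l" for i j
  proof (cases "vs ! j \<rightarrow> vs ! i")
    case True
    have "adj (vs ! i) w * adj w (vs ! j) = (0 :: real)" if "w \<in> far_verts v" for w
      using adjacent[OF True] far_verts_in_verts[OF that] adj_sym[of w "vs ! j"]
      by (auto simp: common_neighbours_def)
    then show ?thesis using sq[OF that] by simp
  next
    case False
    then show ?thesis using A_entry that by simp
  qed
  then have "(A * A * A) $$ (i, i) = 0" if "i < ?l" for i
    using that by (subst index_mult_mat) (auto simp: scalar_prod_def simp del: index_mult_mat(1) intro!: sum.neutral)
  then show "mat_trace (A ^\<^sub>m 3) = 0"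
    unfolding pow by (simp add: mat_trace_def)
qed

end

end

section \<open>The multiplicities\<close>

theorem mainTheorem6:
  fixes X :: "('a, 'b) pre_digraph" and q :: real and c :: nat
    and v :: 'a and vs :: "'a list" and A :: "real mat"
  assumes "srnt_with_parameters X q c"
    and "v \<in> verts X"
    and "distinct vs" and "set vs = verts (second_subconstituent X v)"
    and "A = adjacency_matrix (second_subconstituent X v) vs"
  shows "eigenvalue_multiplicity A (q * (q + real c)) = 1
    \<and> real (eigenvalue_multiplicity A q)
        = (q + 1) * (q^2 + q * real c + real c)
            * (q^2 + 2 * q * real c + (real c)^2 - 2 * real c - q) / (real c * (real c + 2 * q))
    \<and> real (eigenvalue_multiplicity A (- real c))
        = q^2 + q * real c + real c - 1
    \<and> real (eigenvalue_multiplicity A (- (q + real c)))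
        = (q + real c - 1) * (q^2 + q * real c + real c)
            * (q^2 + q - real c) / (real c * (real c + 2 * q))"
proof -
  obtain k where "srnt_graph X k c" and q: "q \<in> srnt_quadratic_roots k c"
    and q_max: "\<And>r. r \<in> srnt_quadratic_roots k c \<Longrightarrow> r \<le> q"
    using assms(1) unfolding srnt_with_parameters_def by blast
  interpret srnt_graph X k c by fact
  have k: "real k = q * (q + real c) + real c"
    using q by (simp add: srnt_quadratic_roots_def power2_eq_square algebra_simps)
  \<comment> \<open>the other root is not larger than \<open>q\<close>, and the product of the roots is negative\<close>
  have "- (q + real c) \<in> srnt_quadratic_roots k c"
    by (simp add: srnt_quadratic_roots_def k power2_eq_square algebra_simps)
  then have "- (q + real c) \<le> q" by (rule q_max)
  moreover have "q * (q + real c) > 0" using k c_less_k by simp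
  ultimately have q_pos: "q > 0" by (auto simp: zero_less_mult_iff)
  have c: "real c \<ge> 1" using c_ge_1 by simp

  let ?S = "{q * (q + real c), q, - real c, - (q + real c)}"
  let ?l = "real (card (far_verts v))"
  let ?m = "\<lambda>a. real (eigenvalue_multiplicity A a)"
  note ctx = assms(2,3,4,5)
  have q_less: "q < q * (q + real c)"
    using q_pos c mult_strict_left_mono[of 1 "q + real c" q] by simp
  have "q * (q + real c) \<noteq> q" "q * (q + real c) \<noteq> - real c" "q * (q + real c) \<noteq> - (q + real c)"
    "q \<noteq> - real c" "q \<noteq> - (q + real c)" "- real c \<noteq> - (q + real c)"
    using q_less q_pos c by linarith+
  then have nodes: "q * (q + real c) \<notin> {q, - real c, - (q + real c)}"
    "q \<notin> {- real c, - (q + real c)}" "- real c \<notin> {- (q + real c)}"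
    by blast+
  \<comment> \<open>\<open>k - c = q (q + c)\<close>, and the quadratic has the roots \<open>q\<close> and \<open>- (q + c)\<close>\<close>
  have spectrum: "e \<in> complex_of_real ` ?S" if "eigenvalue (map_mat complex_of_real A) e" for e
  proof -
    have k': "of_nat k = complex_of_real q * (complex_of_real q + of_nat c) + of_nat c"
      using arg_cong[OF k, of complex_of_real] by simp
    have "e\<^sup>2 + of_nat c * e - (of_nat k - of_nat c)
        = (e - complex_of_real q) * (e + (complex_of_real q + of_nat c))"
      unfolding k' by (simp add: power2_eq_square algebra_simps)
    then have "e = complex_of_real q \<or> e = - (complex_of_real q + of_nat c)"
      if "e\<^sup>2 + of_nat c * e - (of_nat k - of_nat c) = 0"
      using that by (metis eq_neg_iff_add_eq_0 mult_eq_0_iff right_minus_eq)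
    with eigenvalue_cases[OF ctx that]
    have "e = of_nat k - of_nat c \<or> e = - of_nat c \<or> e = complex_of_real q
        \<or> e = - (complex_of_real q + of_nat c)"
      by blast
    then show ?thesis unfolding k' by auto
  qed
  have trace: "mat_trace (A ^\<^sub>m m) = ?m (q * (q + real c)) * (q * (q + real c)) ^ m
      + ?m q * q ^ m + ?m (- real c) * (- real c) ^ m + ?m (- (q + real c)) * (- (q + real c)) ^ m" for m
    using mat_trace_pow_eq_sum_multiplicity[OF A_carrier[OF ctx] _ spectrum, of m] nodes
    by (simp add: add.assoc)
  note tr = A_power_traces[OF ctx, unfolded trace]
  have deg: "real k - real c = q * (q + real c)" using k by simp
  have m0: "?m (q * (q + real c)) + ?m q + ?m (- real c) + ?m (- (q + real c)) = ?l"
    using tr(1) by simp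
  have m1: "?m (q * (q + real c)) * (q * (q + real c)) + ?m q * q + ?m (- real c) * - real c
      + ?m (- (q + real c)) * - (q + real c) = 0"
    using tr(2) by (simp only: power_one_right)
  note m2 = tr(3)[unfolded deg]
  note m3 = tr(4)
  note solution = multiplicities_from_moments[OF q_pos c k card_far_verts[OF assms(2)] m0 m1 m2 m3]
  show ?thesis
    using solution by simp
qed

end
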